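(* Let $G$ be a group, $S \subset G$ finite, $T \subset S$, and $A$ a finite alphabet. Suppose $X = \{x \in A^G : \forall g \in G,\ (gx)|_S \in \mathcal{T}\}$ is defined by a family $\mathcal{T} \subset A^S$ which has $1$-uniform $T$-extensions. Suppose $y, y' \in \{0,1\}^G$ are $(S,T)$-solitaire connected, and let $N, N'$ be the supports of $y, y'$ respectively. Then there is a unique homeomorphism $\phi : X|_N \to X|_{N'}$ such that for all $x \in X$ and all $P \in X|_N$, $x|_N = P \iff x|_{N'} = \phi(P)$.
   Context: Action: $(gx)_h = x_{g^{-1}h}$ for $x \in A^G$. For $N \subset G$, $X|_N = \{x|_N : x \in X\}$ with the topology inherited from the product topology on $A^N$. The support of $y \in \{0,1\}^G$ is $\{g \in G : y_g = 1\}$. $\mathcal{T} \subset A^S$ has $1$-uniform $T$-extensions if for every $s \in T$ and every $P \in A^{S \setminus \{s\}}$ there is exactly one symbol $a \in A$ such that the extension of $P$ to $S$ with value $a$ at $s$ lies in $\mathcal{T}$. The $(S,T)$-solitaire graph has vertex set $\{0,1\}^G$, and $y,y'$ are joined by an edge if there exist $g \in G$ and $a, b \in gT$ with $a \neq b$ such that $y|_{G \setminus \{a,b\}} = y'|_{G \setminus \{a,b\}}$, all entries of $y|_{gS \setminus \{a,b\}} = y'|_{gS \setminus \{a,b\}}$ equal $1$, and $y_a \neq y_b$ and $y'_a \neq y'_b$. Two configurations are $(S,T)$-solitaire connected if they lie in the same connected component of this graph. *)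

theory Defs
  imports "HOL-Analysis.Analysis" "HOL-Algebra.Coset"
begin

text \<open>Configurations and patterns are extensional functions: \<open>A\<^sup>N\<close> is \<open>N \<rightarrow>\<^sub>E A\<close>, and restriction of
  a configuration to \<open>N\<close> is \<^const>\<open>restrict\<close>.\<close>

definition shift :: "('g, 'm) monoid_scheme \<Rightarrow> 'g \<Rightarrow> ('g \<Rightarrow> 'a) \<Rightarrow> 'g \<Rightarrow> 'a" where
  "shift G g x = (\<lambda>h\<in>carrier G. x (inv\<^bsub>G\<^esub> g \<otimes>\<^bsub>G\<^esub> h))"

definition subshift_of ::
  "('g, 'm) monoid_scheme \<Rightarrow> 'a set \<Rightarrow> 'g set \<Rightarrow> ('g \<Rightarrow> 'a) set \<Rightarrow> ('g \<Rightarrow> 'a) set" where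
  "subshift_of G A S \<T> =
     {x \<in> carrier G \<rightarrow>\<^sub>E A. \<forall>g\<in>carrier G. restrict (shift G g x) S \<in> \<T>}"

definition restrict_set :: "('g \<Rightarrow> 'a) set \<Rightarrow> 'g set \<Rightarrow> ('g \<Rightarrow> 'a) set" where
  "restrict_set X N = (\<lambda>x. restrict x N) ` X"

definition restrict_topology :: "'a set \<Rightarrow> ('g \<Rightarrow> 'a) set \<Rightarrow> 'g set \<Rightarrow> ('g \<Rightarrow> 'a) topology" where
  "restrict_topology A X N =
     subtopology (product_topology (\<lambda>_. discrete_topology A) N) (restrict_set X N)"

definition one_uniform_extensions ::
  "'a set \<Rightarrow> 'g set \<Rightarrow> 'g set \<Rightarrow> ('g \<Rightarrow> 'a) set \<Rightarrow> bool" where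
  "one_uniform_extensions A S T \<T> \<longleftrightarrow>
     (\<forall>s\<in>T. \<forall>P\<in>(S - {s}) \<rightarrow>\<^sub>E A. \<exists>!a. a \<in> A \<and> P(s := a) \<in> \<T>)"

definition binary_configs :: "('g, 'm) monoid_scheme \<Rightarrow> ('g \<Rightarrow> nat) set" where
  "binary_configs G = carrier G \<rightarrow>\<^sub>E {0, 1}"

definition support :: "('g, 'm) monoid_scheme \<Rightarrow> ('g \<Rightarrow> nat) \<Rightarrow> 'g set" where
  "support G y = {g \<in> carrier G. y g = 1}"

definition solitaire_edge ::
  "('g, 'm) monoid_scheme \<Rightarrow> 'g set \<Rightarrow> 'g set \<Rightarrow> ('g \<Rightarrow> nat) \<Rightarrow> ('g \<Rightarrow> nat) \<Rightarrow> bool" where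
  "solitaire_edge G S T y y' \<longleftrightarrow>
     y \<in> binary_configs G \<and> y' \<in> binary_configs G \<and>
     (\<exists>g\<in>carrier G. \<exists>a\<in>g <#\<^bsub>G\<^esub> T. \<exists>b\<in>g <#\<^bsub>G\<^esub> T. a \<noteq> b \<and>
        restrict y (carrier G - {a, b}) = restrict y' (carrier G - {a, b}) \<and>
        (\<forall>h\<in>(g <#\<^bsub>G\<^esub> S) - {a, b}. y h = 1) \<and>
        y a \<noteq> y b \<and> y' a \<noteq> y' b)"

text \<open>Lying in the same component of an undirected graph is the equivalence relation generated by
  adjacency.\<close>

definition solitaire_connected ::
  "('g, 'm) monoid_scheme \<Rightarrow> 'g set \<Rightarrow> 'g set \<Rightarrow> ('g \<Rightarrow> nat) \<Rightarrow> ('g \<Rightarrow> nat) \<Rightarrow> bool" where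
  "solitaire_connected G S T y y' \<longleftrightarrow>
     y \<in> binary_configs G \<and> y' \<in> binary_configs G \<and> equivclp (solitaire_edge G S T) y y'"

end

theory Submission
  imports Defs
begin

text \<open>A solitaire move concerns one translate \<open>gS\<close>, of which all cells except one cell \<open>c \<in> gT\<close> are
  occupied.  The values of a configuration \<open>x \<in> X\<close> on those occupied cells leave a single possible
  value at \<open>c\<close>, because \<open>\<T>\<close> has \<open>1\<close>-uniform \<open>T\<close>-extensions.  So before the move the contents of the
  cells of \<open>N\<close> determine those of \<open>N'\<close>, and as moves are reversible the converse holds as well.

  The proof isolates the relation that survives concatenation of moves: every value on \<open>N'\<close> is
  determined by \<^emph>\<open>finitely many\<close> values on \<open>N\<close> (\<open>finitely_determines\<close>).  This relation is
  reflexive and transitive, so it holds in both directions between the supports of connected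
  configurations (\<open>solitaire_connected_determines\<close>).  Determination makes \<open>x|\<^sub>N \<mapsto> x|\<^sub>N\<^sub>'\<close> a
  well-defined map, the finiteness makes it continuous for the product topologies, and determination
  in the other direction provides its continuous inverse.  Uniqueness is immediate, since
  \<open>\<phi> (x|\<^sub>N) = x|\<^sub>N\<^sub>'\<close> is forced for every \<open>x \<in> X\<close>.\<close>


section \<open>Finite determination\<close>

definition finitely_determines :: "('g \<Rightarrow> 'a) set \<Rightarrow> 'g set \<Rightarrow> 'g set \<Rightarrow> bool" where
  "finitely_determines X N N' \<longleftrightarrow>
     (\<forall>c\<in>N'. \<exists>F. finite F \<and> F \<subseteq> N \<and>
        (\<forall>x\<in>X. \<forall>x'\<in>X. (\<forall>i\<in>F. x i = x' i) \<longrightarrow> x c = x' c))"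

lemma finitely_determinesD:
  assumes "finitely_determines X N N'" "c \<in> N'"
  shows "\<exists>F. finite F \<and> F \<subseteq> N \<and>
    (\<forall>x\<in>X. \<forall>x'\<in>X. (\<forall>i\<in>F. x i = x' i) \<longrightarrow> x c = x' c)"
  using assms(1) unfolding finitely_determines_def by (rule bspec) (rule assms(2))

lemma finitely_determines_refl: "finitely_determines X N N"
  unfolding finitely_determines_def
proof
  fix c assume "c \<in> N"
  then show "\<exists>F. finite F \<and> F \<subseteq> N \<and>
      (\<forall>x\<in>X. \<forall>x'\<in>X. (\<forall>i\<in>F. x i = x' i) \<longrightarrow> x c = x' c)"
    by (intro exI[of _ "{c}"]) auto
qed

lemma finitely_determines_trans:
  assumes "finitely_determines X N N'" "finitely_determines X N' N''"
  shows "finitely_determines X N N''"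
  unfolding finitely_determines_def
proof
  fix c assume "c \<in> N''"
  from finitely_determinesD[OF assms(2) this] obtain F where F: "finite F" "F \<subseteq> N'"
    and det: "\<forall>x\<in>X. \<forall>x'\<in>X. (\<forall>i\<in>F. x i = x' i) \<longrightarrow> x c = x' c"
    by (elim exE conjE)
  have "\<forall>d\<in>F. \<exists>E. finite E \<and> E \<subseteq> N \<and>
      (\<forall>x\<in>X. \<forall>x'\<in>X. (\<forall>i\<in>E. x i = x' i) \<longrightarrow> x d = x' d)"
    by (intro ballI finitely_determinesD[OF assms(1)] subsetD[OF F(2)])
  from bchoice[OF this] obtain E where E: "\<forall>d\<in>F. finite (E d) \<and> E d \<subseteq> N \<and>
      (\<forall>x\<in>X. \<forall>x'\<in>X. (\<forall>i\<in>E d. x i = x' i) \<longrightarrow> x d = x' d)"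
    by (rule exE)
  show "\<exists>F. finite F \<and> F \<subseteq> N \<and>
      (\<forall>x\<in>X. \<forall>x'\<in>X. (\<forall>i\<in>F. x i = x' i) \<longrightarrow> x c = x' c)"
  proof (intro exI[of _ "\<Union>d\<in>F. E d"] conjI ballI impI)
    show "finite (\<Union>d\<in>F. E d)" "(\<Union>d\<in>F. E d) \<subseteq> N"
      using F(1) E by auto
    fix x x' assume xx': "x \<in> X" "x' \<in> X" and agree: "\<forall>i\<in>(\<Union>d\<in>F. E d). x i = x' i"
    have "x d = x' d" if d: "d \<in> F" for d
    proof -
      have "\<forall>i\<in>E d. x i = x' i" using agree d by simp
      then show ?thesis using E d xx' by simp
    qed
    then show "x c = x' c" using det xx' by simp
  qed
qed

lemma finitely_determines_restrict:
  assumes "finitely_determines X N N'" "x \<in> X" "x' \<in> X" "restrict x N = restrict x' N"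
  shows "restrict x N' = restrict x' N'"
proof (rule restrict_ext)
  fix c assume "c \<in> N'"
  from finitely_determinesD[OF assms(1) this] obtain F where "F \<subseteq> N"
    and det: "\<forall>x\<in>X. \<forall>x'\<in>X. (\<forall>i\<in>F. x i = x' i) \<longrightarrow> x c = x' c"
    by (elim exE conjE)
  have "x i = x' i" if "i \<in> F" for i
    using fun_cong[OF assms(4), of i] that \<open>F \<subseteq> N\<close> by auto
  then show "x c = x' c" using det assms(2,3) by simp
qed


section \<open>Solitaire moves\<close>

text \<open>Shifting by \<open>g\<inverse>\<close> moves the window \<open>gS\<close> onto \<open>S\<close>.\<close>

lemma subshift_of_window:
  assumes "group G" "S \<subseteq> carrier G" "x \<in> subshift_of G A S \<T>" "g \<in> carrier G"
  shows "(\<lambda>t\<in>S. x (g \<otimes>\<^bsub>G\<^esub> t)) \<in> \<T>"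
proof -
  have "restrict (shift G (inv\<^bsub>G\<^esub> g) x) S = (\<lambda>t\<in>S. x (g \<otimes>\<^bsub>G\<^esub> t))"
    using assms(2,4) group.inv_inv[OF assms(1,4)] unfolding shift_def
    by (auto simp: restrict_def fun_eq_iff)
  then show ?thesis
    using assms unfolding subshift_of_def by (metis (mono_tags, lifting) group.inv_closed mem_Collect_eq)
qed

text \<open>Two configurations of \<open>X\<close> that agree on \<open>gS - {gs}\<close> show in the window \<open>gS\<close> two patterns of
  \<open>\<T>\<close> extending the same element of \<open>A\<^bsup>S - {s}\<^esup>\<close>.\<close>

lemma one_uniform_extension_unique:
  assumes "group G" "S \<subseteq> carrier G" "T \<subseteq> S" "one_uniform_extensions A S T \<T>"
    and x: "x \<in> subshift_of G A S \<T>" and x': "x' \<in> subshift_of G A S \<T>"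
    and g: "g \<in> carrier G" and s: "s \<in> T"
    and agree: "\<forall>i\<in>(g <#\<^bsub>G\<^esub> S) - {g \<otimes>\<^bsub>G\<^esub> s}. x i = x' i"
  shows "x (g \<otimes>\<^bsub>G\<^esub> s) = x' (g \<otimes>\<^bsub>G\<^esub> s)"
proof -
  interpret group G by fact
  have sS: "s \<in> S" using s assms(3) by blast
  define P where "P = (\<lambda>t\<in>S - {s}. x (g \<otimes>\<^bsub>G\<^esub> t))"
  have in_A: "z (g \<otimes>\<^bsub>G\<^esub> t) \<in> A" if "z \<in> subshift_of G A S \<T>" "t \<in> S" for z t
    using that g assms(2) unfolding subshift_of_def by auto
  have "P \<in> (S - {s}) \<rightarrow>\<^sub>E A"
    unfolding P_def using in_A[OF x] by auto
  then have uniq: "\<exists>!a. a \<in> A \<and> P(s := a) \<in> \<T>"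
    using assms(4) s unfolding one_uniform_extensions_def by blast
  have "P(s := x (g \<otimes>\<^bsub>G\<^esub> s)) = (\<lambda>t\<in>S. x (g \<otimes>\<^bsub>G\<^esub> t))"
    unfolding P_def using sS by (auto simp: fun_eq_iff)
  moreover have "P(s := x' (g \<otimes>\<^bsub>G\<^esub> s)) = (\<lambda>t\<in>S. x' (g \<otimes>\<^bsub>G\<^esub> t))"
  proof
    fix t
    have "x (g \<otimes>\<^bsub>G\<^esub> t) = x' (g \<otimes>\<^bsub>G\<^esub> t)" if "t \<in> S" "t \<noteq> s"
    proof -
      have "g \<otimes>\<^bsub>G\<^esub> t \<noteq> g \<otimes>\<^bsub>G\<^esub> s"
        using that sS g assms(2) by (simp add: subset_iff)
      moreover have "g \<otimes>\<^bsub>G\<^esub> t \<in> g <#\<^bsub>G\<^esub> S"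
        using that unfolding l_coset_def by blast
      ultimately show ?thesis using agree by blast
    qed
    then show "(P(s := x' (g \<otimes>\<^bsub>G\<^esub> s))) t = (\<lambda>t\<in>S. x' (g \<otimes>\<^bsub>G\<^esub> t)) t"
      unfolding P_def using sS by auto
  qed
  ultimately show ?thesis
    using uniq in_A[OF x sS] in_A[OF x' sS]
      subshift_of_window[OF assms(1,2) x g] subshift_of_window[OF assms(1,2) x' g] by metis
qed

lemma solitaire_edge_sym:
  assumes "group G" "S \<subseteq> carrier G" "solitaire_edge G S T y y'"
  shows "solitaire_edge G S T y' y"
proof -
  interpret group G by fact
  obtain g a b where g: "g \<in> carrier G" and ab: "a \<in> g <#\<^bsub>G\<^esub> T" "b \<in> g <#\<^bsub>G\<^esub> T" "a \<noteq> b"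
    and off: "restrict y (carrier G - {a, b}) = restrict y' (carrier G - {a, b})"
    and ones: "\<forall>h\<in>(g <#\<^bsub>G\<^esub> S) - {a, b}. y h = 1"
    and ne: "y a \<noteq> y b" "y' a \<noteq> y' b"
    and bin: "y \<in> binary_configs G" "y' \<in> binary_configs G"
    using assms(3) unfolding solitaire_edge_def by blast
  have "g <#\<^bsub>G\<^esub> S \<subseteq> carrier G" by (rule l_coset_subset_G[OF assms(2) g])
  then have "y' h = 1" if "h \<in> (g <#\<^bsub>G\<^esub> S) - {a, b}" for h
    using that ones fun_cong[OF off, of h] by auto
  then show ?thesis
    unfolding solitaire_edge_def using g ab off[symmetric] ne bin by blast
qed

lemma solitaire_edge_determines:
  assumes "group G" "S \<subseteq> carrier G" "finite S" "T \<subseteq> S" "one_uniform_extensions A S T \<T>"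
    and "solitaire_edge G S T y y'"
  shows "finitely_determines (subshift_of G A S \<T>) (support G y) (support G y')"
  unfolding finitely_determines_def
proof
  interpret group G by fact
  fix c assume c: "c \<in> support G y'"
  let ?X = "subshift_of G A S \<T>"
  obtain g a b where g: "g \<in> carrier G" and ab: "a \<in> g <#\<^bsub>G\<^esub> T" "b \<in> g <#\<^bsub>G\<^esub> T"
    and off: "restrict y (carrier G - {a, b}) = restrict y' (carrier G - {a, b})"
    and ones: "\<forall>h\<in>(g <#\<^bsub>G\<^esub> S) - {a, b}. y h = 1"
    and ne: "y a \<noteq> y b"
    and bin: "y \<in> binary_configs G"
    using assms(6) unfolding solitaire_edge_def by blast
  have gS: "g <#\<^bsub>G\<^esub> S \<subseteq> carrier G" by (rule l_coset_subset_G[OF assms(2) g])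
  have gT: "g <#\<^bsub>G\<^esub> T \<subseteq> g <#\<^bsub>G\<^esub> S" using assms(4) unfolding l_coset_def by blast
  show "\<exists>F. finite F \<and> F \<subseteq> support G y \<and>
      (\<forall>x\<in>?X. \<forall>x'\<in>?X. (\<forall>i\<in>F. x i = x' i) \<longrightarrow> x c = x' c)"
  proof (cases "c \<in> support G y")
    case True
    then show ?thesis by (intro exI[of _ "{c}"]) auto
  next
    case False
    have cab: "c \<in> {a, b}"
      using c False fun_cong[OF off, of c] unfolding support_def
      by (auto simp: restrict_def split: if_splits)
    \<comment> \<open>As \<open>c\<close> is empty before the move, the other one of \<open>a\<close> and \<open>b\<close> is occupied, hence so is all of
      \<open>gS\<close> apart from \<open>c\<close>.\<close>
    have bin01: "y a = 0 \<or> y a = 1" "y b = 0 \<or> y b = 1"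
      using bin ab gT gS unfolding binary_configs_def by auto
    have "y c \<noteq> 1" using False c unfolding support_def by auto
    then have "y h = 1" if "h \<in> (g <#\<^bsub>G\<^esub> S) - {c}" for h
      using that cab bin01 ne ones by (cases "h \<in> {a, b}") auto
    then have "(g <#\<^bsub>G\<^esub> S) - {c} \<subseteq> support G y"
      using gS unfolding support_def by auto
    moreover have "finite ((g <#\<^bsub>G\<^esub> S) - {c})"
      using assms(3) unfolding l_coset_def by auto
    moreover have "\<forall>x\<in>?X. \<forall>x'\<in>?X. (\<forall>i\<in>(g <#\<^bsub>G\<^esub> S) - {c}. x i = x' i) \<longrightarrow> x c = x' c"
    proof -
      obtain s where s: "s \<in> T" "c = g \<otimes>\<^bsub>G\<^esub> s"
        using cab ab unfolding l_coset_def by blast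
      show ?thesis
        unfolding s(2)
        by (intro ballI impI) (rule one_uniform_extension_unique[OF assms(1,2,4,5) _ _ g s(1)])
    qed
    ultimately show ?thesis
      by (intro exI[of _ "(g <#\<^bsub>G\<^esub> S) - {c}"] conjI)
  qed
qed

lemma solitaire_connected_determines:
  assumes "group G" "S \<subseteq> carrier G" "finite S" "T \<subseteq> S" "one_uniform_extensions A S T \<T>"
    and "solitaire_connected G S T y y'"
  shows "finitely_determines (subshift_of G A S \<T>) (support G y) (support G y')"
    and "finitely_determines (subshift_of G A S \<T>) (support G y') (support G y)"
proof -
  let ?D = "\<lambda>y y'. finitely_determines (subshift_of G A S \<T>) (support G y) (support G y')"
  have edge: "?D z z' \<and> ?D z' z"
    if "solitaire_edge G S T z z' \<or> solitaire_edge G S T z' z" for z z'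
    using that solitaire_edge_determines[OF assms(1-5)] solitaire_edge_sym[OF assms(1,2)] by metis
  have "equivclp (solitaire_edge G S T) y y'"
    using assms(6) unfolding solitaire_connected_def by blast
  then have "?D y y' \<and> ?D y' y"
  proof (induction rule: equivclp_induct)
    case base
    show ?case by (simp add: finitely_determines_refl)
  next
    case (step z z')
    then show ?case using edge[of z z'] by (meson finitely_determines_trans)
  qed
  then show "?D y y'" "?D y' y" by auto
qed


section \<open>The transfer map\<close>

text \<open>Any \<open>x \<in> X\<close> extending \<open>P\<close> may be used: if \<open>N\<close> determines \<open>N'\<close>, the choice does not matter.\<close>

definition transfer :: "('g \<Rightarrow> 'a) set \<Rightarrow> 'g set \<Rightarrow> 'g set \<Rightarrow> ('g \<Rightarrow> 'a) \<Rightarrow> 'g \<Rightarrow> 'a" where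
  "transfer X N N' = (\<lambda>P\<in>restrict_set X N. restrict (SOME x. x \<in> X \<and> restrict x N = P) N')"

lemma transfer_restrict:
  assumes "finitely_determines X N N'" "x \<in> X"
  shows "transfer X N N' (restrict x N) = restrict x N'"
proof -
  define z where "z = (SOME z. z \<in> X \<and> restrict z N = restrict x N)"
  have "z \<in> X \<and> restrict z N = restrict x N"
    unfolding z_def by (rule someI[of _ x]) (use assms(2) in simp)
  then have "restrict z N' = restrict x N'"
    using finitely_determines_restrict[OF assms(1)] assms(2) by blast
  then show ?thesis
    using assms(2) unfolding transfer_def z_def restrict_set_def by auto
qed

lemma topspace_restrict_topology:
  assumes "X \<subseteq> I \<rightarrow>\<^sub>E A" "N \<subseteq> I"
  shows "topspace (restrict_topology A X N) = restrict_set X N"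
  using assms unfolding restrict_topology_def restrict_set_def by (auto 0 3 simp: PiE_def Pi_def)

text \<open>The value of the image at a cell depends only on the values on a finite set of cells, so it is
  constant on cylinder sets, and these are open.\<close>

lemma continuous_map_transfer:
  assumes X: "X \<subseteq> I \<rightarrow>\<^sub>E A" and N: "N \<subseteq> I" "N' \<subseteq> I" and det: "finitely_determines X N N'"
  shows "continuous_map (restrict_topology A X N) (restrict_topology A X N') (transfer X N N')"
proof -
  note top = topspace_restrict_topology[OF X N(1)]
  have coord: "continuous_map (restrict_topology A X N) (discrete_topology A) (\<lambda>P. transfer X N N' P c)"
    if c: "c \<in> N'" for c
    unfolding continuous_map_def
  proof (intro conjI allI impI)
    have "restrict x N' c \<in> A" if "x \<in> X" for x
      using that c X N(2) by auto
    then show "(\<lambda>P. transfer X N N' P c) \<in>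
        topspace (restrict_topology A X N) \<rightarrow> topspace (discrete_topology A)"
      unfolding top by (auto simp: restrict_set_def transfer_restrict[OF det])
    fix U
    let ?W = "{P \<in> topspace (restrict_topology A X N). transfer X N N' P c \<in> U}"
    obtain F where F: "finite F" "F \<subseteq> N"
      and dc: "\<forall>x\<in>X. \<forall>x'\<in>X. (\<forall>i\<in>F. x i = x' i) \<longrightarrow> x c = x' c"
      using finitely_determinesD[OF det c] by (elim exE conjE)
    show "openin (restrict_topology A X N) ?W"
    proof (subst openin_subopen, intro ballI)
      fix P assume P: "P \<in> ?W"
      then obtain x where x: "x \<in> X" "P = restrict x N"
        unfolding top restrict_set_def by blast
      have xA: "x i \<in> A" if "i \<in> N" for i using x(1) X N(1) that by auto
      define C where "C = (\<Pi>\<^sub>E i\<in>N. if i \<in> F then {x i} else A)"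
      have "finite {i \<in> N. (if i \<in> F then {x i} else A) \<noteq> A}"
        by (rule finite_subset[OF _ F(1)]) (auto split: if_splits)
      then have "openin (product_topology (\<lambda>_. discrete_topology A) N) C"
        unfolding C_def openin_PiE_gen topspace_discrete_topology using xA
        by (intro disjI2 conjI ballI) (assumption, auto)
      then have "openin (restrict_topology A X N) (C \<inter> restrict_set X N)"
        unfolding restrict_topology_def by (auto simp: openin_subtopology)
      moreover have "P \<in> C \<inter> restrict_set X N"
        using x xA unfolding C_def restrict_set_def by auto
      moreover have "C \<inter> restrict_set X N \<subseteq> ?W"
      proof
        fix Q assume Q: "Q \<in> C \<inter> restrict_set X N"
        then obtain z where z: "z \<in> X" "Q = restrict z N"
          unfolding restrict_set_def by blast
        have "z i = x i" if "i \<in> F" for i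
        proof -
          have iN: "i \<in> N" using that F(2) by blast
          then have "Q i \<in> (if i \<in> F then {x i} else A)"
            using Q unfolding C_def by (blast dest: PiE_mem)
          then show ?thesis using that z(2) iN by simp
        qed
        then have "z c = x c" using dc z(1) x(1) by simp
        then show "Q \<in> ?W"
          using P Q x z c unfolding top by (simp add: transfer_restrict[OF det])
      qed
      ultimately show "\<exists>V. openin (restrict_topology A X N) V \<and> P \<in> V \<and> V \<subseteq> ?W"
        by blast
    qed
  qed
  have "transfer X N N' ` restrict_set X N \<subseteq> restrict_set X N'"
    by (auto simp: restrict_set_def transfer_restrict[OF det])
  moreover have "transfer X N N' ` restrict_set X N \<subseteq> extensional N'"
    by (auto simp: restrict_set_def transfer_restrict[OF det])
  ultimately show ?thesis
    unfolding restrict_topology_def[of A X N'] continuous_map_in_subtopology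
      continuous_map_componentwise top
    using coord by (auto simp: top)
qed

lemma homeomorphic_map_transfer:
  assumes X: "X \<subseteq> I \<rightarrow>\<^sub>E A" and N: "N \<subseteq> I" "N' \<subseteq> I"
    and det: "finitely_determines X N N'" "finitely_determines X N' N"
  shows "homeomorphic_map (restrict_topology A X N) (restrict_topology A X N') (transfer X N N')"
proof -
  have "homeomorphic_maps (restrict_topology A X N) (restrict_topology A X N')
      (transfer X N N') (transfer X N' N)"
    unfolding homeomorphic_maps_def topspace_restrict_topology[OF X N(1)]
      topspace_restrict_topology[OF X N(2)]
    using continuous_map_transfer[OF X N det(1)] continuous_map_transfer[OF X N(2,1) det(2)]
    by (auto simp: restrict_set_def transfer_restrict[OF det(1)] transfer_restrict[OF det(2)])
  then show ?thesis using homeomorphic_map_maps by blast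
qed

theorem lemma33:
  fixes G :: "('g, 'm) monoid_scheme"
    and A :: "'a set" and S T N N' :: "'g set"
    and \<T> X :: "('g \<Rightarrow> 'a) set"
    and y y' :: "'g \<Rightarrow> nat"
  assumes "group G"
    and "S \<subseteq> carrier G" "finite S" "T \<subseteq> S"
    and "finite A"
    and "\<T> \<subseteq> S \<rightarrow>\<^sub>E A"
    and "one_uniform_extensions A S T \<T>"
    and "X = subshift_of G A S \<T>"
    and "y \<in> binary_configs G" "y' \<in> binary_configs G"
    and "solitaire_connected G S T y y'"
    and "N = support G y" "N' = support G y'"
  shows "\<exists>!\<phi>. \<phi> \<in> extensional (restrict_set X N) \<and>
           homeomorphic_map (restrict_topology A X N) (restrict_topology A X N') \<phi> \<and>
           (\<forall>x\<in>X. \<forall>P\<in>restrict_set X N. restrict x N = P \<longleftrightarrow> restrict x N' = \<phi> P)"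
proof -
  have X: "X \<subseteq> carrier G \<rightarrow>\<^sub>E A"
    using assms(8) unfolding subshift_of_def by blast
  have N: "N \<subseteq> carrier G" "N' \<subseteq> carrier G"
    using assms(12,13) unfolding support_def by auto
  have det: "finitely_determines X N N'" "finitely_determines X N' N"
    using solitaire_connected_determines[OF assms(1-4,7,11)] assms(8,12,13) by auto
  show ?thesis
  proof (rule ex1I[of _ "transfer X N N'"], intro conjI ballI)
    show "transfer X N N' \<in> extensional (restrict_set X N)"
      unfolding transfer_def by simp
    show "homeomorphic_map (restrict_topology A X N) (restrict_topology A X N') (transfer X N N')"
      by (rule homeomorphic_map_transfer[OF X N det])
    fix x P assume x: "x \<in> X" and "P \<in> restrict_set X N"
    then obtain z where z: "z \<in> X" "P = restrict z N"
      unfolding restrict_set_def by blast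
    show "restrict x N = P \<longleftrightarrow> restrict x N' = transfer X N N' P"
      using finitely_determines_restrict[OF det(1) x z(1)]
        finitely_determines_restrict[OF det(2) x z(1)] z(2) transfer_restrict[OF det(1) z(1)] by auto
  next
    fix \<phi>
    assume \<phi>: "\<phi> \<in> extensional (restrict_set X N) \<and>
      homeomorphic_map (restrict_topology A X N) (restrict_topology A X N') \<phi> \<and>
      (\<forall>x\<in>X. \<forall>P\<in>restrict_set X N. restrict x N = P \<longleftrightarrow> restrict x N' = \<phi> P)"
    show "\<phi> = transfer X N N'"
    proof (rule extensionalityI[of _ "restrict_set X N"])
      show "\<phi> \<in> extensional (restrict_set X N)" using \<phi> by blast
      show "transfer X N N' \<in> extensional (restrict_set X N)" unfolding transfer_def by simp
      fix P assume P: "P \<in> restrict_set X N"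
      then obtain z where z: "z \<in> X" "P = restrict z N"
        unfolding restrict_set_def by blast
      then have "\<phi> P = restrict z N'" using \<phi> P by metis
      then show "\<phi> P = transfer X N N' P" using transfer_restrict[OF det(1) z(1)] z(2) by simp
    qed
  qed
qed

end
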